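(* For any period $n\in\{1,\dots,N\}$ and any initial inventory $x$ that is not an $\mathbf{s}$ threshold for period $n$, there exists a $\mathbf{C}$ threshold: a value $\mathbf{C}$ (possibly depending on $x$) such that if the initial cash satisfies $R\le\mathbf{C}$, then it is better for the retailer not to order, i.e. $y=x$ attains the maximum in the optimality equation for $F_n(x,R)$. Moreover, each of the following can serve as a $\mathbf{C}$ threshold: $$\mathbf{C}=K,$$ and $$\mathbf{C}=\max\{R \mid x+B(R)\le D_b,\; pB(R)\le K+cB(R)\}$$ (the latter whenever this maximum exists).
   Context: Cash-constrained inventory model with periods $1,\dots,N$. The demands $\xi_1,\dots,\xi_N$ are independent, non-negative, discrete random variables, not necessarily identically distributed, with values in $[D_b,D_u]$, where $0\le D_b\le D_u<\infty$ are the minimum and maximum possible demand values. Parameters: fixed ordering cost $K\ge 0$, unit variable ordering cost $c$, selling price $p$, unit salvage value $\gamma$, per-period overhead cost $W\ge 0$, with $0\le\gamma<c<p$. Unmet demand is lost, lead time is zero, there is no inventory holding cost, and excess stock is carried over to the next period. Write $(z)^+=\max\{z,0\}$, and let $\delta(z)=1$ for $z>0$, $\delta(0)=0$. At the beginning of period $n$ the state is $(x,R)$, with $x\ge0$ the initial inventory and $R$ the initial cash. The action is the order-up-to level $y$; the order quantity is $y-x$. The cash constraint requires $x\le y\le x+B(R)$, where $$B(R)=\max\left\{0,\frac{R-K-W}{c}\right\}.$$ The cash increment in the period is $$\Delta R=p\min\{\xi_n,y\}-K\delta(y-x)-c(y-x)-W,$$ and the next state is $((y-\xi_n)^+,R+\Delta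 R)$. The maximum expected cash increment from period $n$ to the end of the horizon is defined by $F_{N+1}(x,R)=\gamma x$ and, for $n\le N$, by the optimality equation $$F_n(x,R)=\max_{x\le y\le x+B(R)}\Big\{E[\Delta R]+E\big[F_{n+1}((y-\xi_n)^+,R+\Delta R)\big]\Big\},$$ where expectations are over $\xi_n$. A value $s$ is called an $\mathbf{s}$ threshold for period $n$ if for every initial inventory $x'\ge s$ and every initial cash $R$ it is optimal not to order, i.e. $y=x'$ attains the maximum in the optimality equation for $F_n(x',R)$. *)

theory Defs
  imports "HOL-Probability.Probability"
begin

definition order_ind :: "real \<Rightarrow> real"
  where "order_ind z = (if z > 0 then 1 else 0)"

text \<open>Parameters: horizon \<open>N\<close>, demand \<open>\<xi> n\<close> in period \<open>n\<close>, demand bounds \<open>D\<^sub>b\<close> and \<open>D\<^sub>u\<close>,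
  fixed ordering cost \<open>K\<close>, unit ordering cost \<open>c\<close>, price \<open>p\<close>, unit salvage value \<open>\<gamma>\<close>,
  overhead cost \<open>W\<close>.  Discreteness of a demand is countability of its range.\<close>

locale cash_inventory = prob_space M for M :: "'a measure" +
  fixes N :: nat
    and \<xi> :: "nat \<Rightarrow> 'a \<Rightarrow> real"
    and D\<^sub>b D\<^sub>u K c p \<gamma> W :: real
  assumes demand_indep: "indep_vars (\<lambda>_. borel) \<xi> {1..N}"
    and demand_discrete: "\<And>n. n \<in> {1..N} \<Longrightarrow> countable (\<xi> n ` space M)"
    and demand_range: "\<And>n \<omega>. n \<in> {1..N} \<Longrightarrow> \<omega> \<in> space M \<Longrightarrow> \<xi> n \<omega> \<in> {D\<^sub>b..D\<^sub>u}"
    and demand_bounds: "0 \<le> D\<^sub>b" "D\<^sub>b \<le> D\<^sub>u"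
    and costs_nonneg: "0 \<le> K" "0 \<le> W"
    and prices: "0 \<le> \<gamma>" "\<gamma> < c" "c < p"
begin

definition B :: "real \<Rightarrow> real"
  where "B R = max 0 ((R - K - W) / c)"

definition feasible :: "real \<Rightarrow> real \<Rightarrow> real set"
  where "feasible x R = {x..x + B R}"

definition cash_incr :: "real \<Rightarrow> real \<Rightarrow> real \<Rightarrow> real"
  where "cash_incr d x y = p * min d y - K * order_ind (y - x) - c * (y - x) - W"

text \<open>The bracket of the optimality equation for period \<open>n\<close>, as a function of the order-up-to
  level \<open>y\<close>, with \<open>V\<close> in place of the value function of period \<open>n + 1\<close>.\<close>

definition objective ::
  "(real \<Rightarrow> real \<Rightarrow> real) \<Rightarrow> nat \<Rightarrow> real \<Rightarrow> real \<Rightarrow> real \<Rightarrow> real"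
  where "objective V n x R y =
    expectation (\<lambda>\<omega>. cash_incr (\<xi> n \<omega>) x y) +
    expectation (\<lambda>\<omega>. V (max 0 (y - \<xi> n \<omega>)) (R + cash_incr (\<xi> n \<omega>) x y))"

text \<open>The maximum over the compact feasible interval is written as a supremum; it is attained,
  since the objective is upper semicontinuous in \<open>y\<close> and bounded above.\<close>

function F :: "nat \<Rightarrow> real \<Rightarrow> real \<Rightarrow> real"
  where "F n = (if n \<le> N
    then (\<lambda>x R. SUP y\<in>feasible x R. objective (F (Suc n)) n x R y)
    else (\<lambda>x R. \<gamma> * x))"
  by auto
termination by (relation "Wellfounded.measure (\<lambda>n. Suc N - n)") auto

declare F.simps [simp del]

definition optimal_level :: "nat \<Rightarrow> real \<Rightarrow> real \<Rightarrow> real \<Rightarrow> bool"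
  where "optimal_level n x R y \<longleftrightarrow>
    is_arg_max (objective (F (Suc n)) n x R) (\<lambda>z. z \<in> feasible x R) y"

definition s_threshold :: "nat \<Rightarrow> real \<Rightarrow> bool"
  where "s_threshold n s \<longleftrightarrow> (\<forall>x'\<ge>0. x' \<ge> s \<longrightarrow> (\<forall>R. optimal_level n x' R x'))"

definition C_threshold :: "nat \<Rightarrow> real \<Rightarrow> real \<Rightarrow> bool"
  where "C_threshold n x C \<longleftrightarrow> (\<forall>R\<le>C. optimal_level n x R x)"

end

end

theory Submission
  imports Defs
begin

text \<open>With cash at most \<open>K\<close> no order is affordable.  For the second threshold, every
  affordable order is sold completely, so it leaves the same (empty) stock as not ordering, while its
  margin does not cover the fixed cost.  Hence it ends with less cash, and
  \<open>F\<close> is nondecreasing in cash.\<close>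

context cash_inventory
begin

lemma price_pos: "0 < c" "0 < p"
  using prices by auto

text \<open>The demand has countable range, and every function is measurable on a countable discrete
  space. Hence \<open>f\<close> may be arbitrary, which lets \<open>F\<close>, defined by suprema
  over intervals, be integrated directly.\<close>

lemma borel_measurable_demand:
  fixes f :: "real \<Rightarrow> real"
  assumes "n \<in> {1..N}"
  shows "(\<lambda>\<omega>. f (\<xi> n \<omega>)) \<in> borel_measurable M"
proof -
  have "\<xi> n \<in> borel_measurable M"
    using demand_indep assms unfolding indep_vars_def by auto
  then have "\<xi> n \<in> M \<rightarrow>\<^sub>M count_space (\<xi> n ` space M)"
    using demand_discrete[OF assms]
    by (auto simp: measurable_count_space_eq_countable)
  then show ?thesis
    by (rule measurable_compose) simp
qed

lemma integrable_demand:
  fixes f :: "real \<Rightarrow> real"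
  assumes "n \<in> {1..N}" and "\<And>d. d \<in> {D\<^sub>b..D\<^sub>u} \<Longrightarrow> l \<le> f d \<and> f d \<le> u"
  shows "integrable M (\<lambda>\<omega>. f (\<xi> n \<omega>))"
proof (rule integrable_const_bound[where B = "max \<bar>l\<bar> \<bar>u\<bar>"])
  have "norm (f (\<xi> n \<omega>)) \<le> max \<bar>l\<bar> \<bar>u\<bar>" if "\<omega> \<in> space M" for \<omega>
    using assms(2)[OF demand_range[OF assms(1) that]] by auto
  then show "AE \<omega> in M. norm (f (\<xi> n \<omega>)) \<le> max \<bar>l\<bar> \<bar>u\<bar>"
    by simp
qed (rule borel_measurable_demand[OF assms(1)])

text \<open>The ordering cost stays in the bound because \<open>objective_le\<close> sets it against
  the salvage value of the stock ordered.\<close>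

lemma cash_incr_le:
  assumes "d \<in> {D\<^sub>b..D\<^sub>u}"
  shows "cash_incr d x y \<le> p * D\<^sub>u - c * (y - x)"
proof -
  have "p * min d y \<le> p * D\<^sub>u"
    using assms price_pos by (intro mult_left_mono) auto
  moreover have "0 \<le> K * order_ind (y - x)"
    using costs_nonneg by (simp add: order_ind_def)
  ultimately show ?thesis
    using costs_nonneg by (simp add: cash_incr_def)
qed

lemma cash_incr_ge:
  assumes "d \<in> {D\<^sub>b..D\<^sub>u}" "0 \<le> y"
  shows "- K * order_ind (y - x) - c * (y - x) - W \<le> cash_incr d x y"
proof -
  have "0 \<le> p * min d y"
    using assms price_pos demand_bounds by simp
  then show ?thesis
    by (simp add: cash_incr_def)
qed

lemma integrable_cash_incr:
  assumes "n \<in> {1..N}" "0 \<le> y"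
  shows "integrable M (\<lambda>\<omega>. cash_incr (\<xi> n \<omega>) x y)"
  by (rule integrable_demand[OF assms(1)]) (use cash_incr_le cash_incr_ge assms(2) in blast)

text \<open>For fixed \<open>y\<close> the leftover stock lies in \<open>{0..y}\<close>, so bounds
  on \<open>V\<close> that grow at most linearly in the stock and are uniform in cash make the
  integrand bounded.\<close>

lemma integrable_continuation:
  assumes n: "n \<in> {1..N}" and y: "0 \<le> y" and "0 \<le> a"
    and V: "\<And>x R. 0 \<le> x \<Longrightarrow> l \<le> V x R \<and> V x R \<le> u + a * x"
  shows "integrable M (\<lambda>\<omega>. V (max 0 (y - \<xi> n \<omega>)) (R + cash_incr (\<xi> n \<omega>) x y))"
proof (rule integrable_demand[OF n, where l = l and u = "u + a * y"])
  fix d assume "d \<in> {D\<^sub>b..D\<^sub>u}"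
  then have "a * max 0 (y - d) \<le> a * y"
    using \<open>0 \<le> a\<close> y demand_bounds by (intro mult_left_mono) auto
  then show "l \<le> V (max 0 (y - d)) (R + cash_incr d x y)
      \<and> V (max 0 (y - d)) (R + cash_incr d x y) \<le> u + a * y"
    using V[of "max 0 (y - d)" "R + cash_incr d x y"] by simp
qed

lemma B_nonneg: "0 \<le> B R"
  by (simp add: B_def)

lemma B_mono: "R \<le> R' \<Longrightarrow> B R \<le> B R'"
  using price_pos unfolding B_def by (intro max.mono divide_right_mono) auto

text \<open>Ordering raises the stock term of the bound on \<open>V\<close> by
  \<open>\<gamma> * (y - x)\<close> but costs \<open>c * (y - x)\<close>, which is at least as much.
  So the bound is free of \<open>y\<close> and keeps the form constant plus
  \<open>\<gamma> * x\<close>, ready for backward induction.\<close>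

lemma objective_le:
  assumes n: "n \<in> {1..N}" and x: "0 \<le> x" and y: "x \<le> y"
    and V: "\<And>x R. 0 \<le> x \<Longrightarrow> l \<le> V x R \<and> V x R \<le> u + \<gamma> * x"
  shows "objective V n x R y \<le> p * D\<^sub>u + u + \<gamma> * x"
proof -
  note n_range = demand_range[OF n]
  have y0: "0 \<le> y"
    using x y by simp
  have "expectation (\<lambda>\<omega>. cash_incr (\<xi> n \<omega>) x y) \<le> p * D\<^sub>u - c * (y - x)"
    by (intro integral_le_const integrable_cash_incr n y0 AE_I2 cash_incr_le n_range)
  moreover have "expectation (\<lambda>\<omega>. V (max 0 (y - \<xi> n \<omega>)) (R + cash_incr (\<xi> n \<omega>) x y))
      \<le> u + \<gamma> * y"
  proof (intro integral_le_const integrable_continuation[OF n y0 prices(1) V] AE_I2)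
    fix \<omega> assume "\<omega> \<in> space M"
    then have "\<gamma> * max 0 (y - \<xi> n \<omega>) \<le> \<gamma> * y"
      using n_range[of \<omega>] prices y0 demand_bounds by (intro mult_left_mono) auto
    then show "V (max 0 (y - \<xi> n \<omega>)) (R + cash_incr (\<xi> n \<omega>) x y) \<le> u + \<gamma> * y"
      using V[of "max 0 (y - \<xi> n \<omega>)" "R + cash_incr (\<xi> n \<omega>) x y"] by simp
  qed
  moreover have "\<gamma> * (y - x) \<le> c * (y - x)"
    using prices y by (intro mult_right_mono) auto
  ultimately show ?thesis
    by (simp add: objective_def algebra_simps)
qed

text \<open>A period without an order loses at most the overhead \<open>W\<close>, whatever the
  demand.\<close>

lemma objective_no_order_ge:
  assumes n: "n \<in> {1..N}" and x: "0 \<le> x"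
    and V: "\<And>x R. 0 \<le> x \<Longrightarrow> l \<le> V x R \<and> V x R \<le> u + \<gamma> * x"
  shows "l - W \<le> objective V n x R x"
proof -
  have "- W \<le> expectation (\<lambda>\<omega>. cash_incr (\<xi> n \<omega>) x x)"
    using cash_incr_ge[OF demand_range[OF n] x, of _ x]
    by (intro integral_ge_const integrable_cash_incr n x AE_I2) (simp add: order_ind_def)
  moreover have "l \<le> expectation (\<lambda>\<omega>. V (max 0 (x - \<xi> n \<omega>)) (R + cash_incr (\<xi> n \<omega>) x x))"
    by (intro integral_ge_const integrable_continuation[OF n x prices(1) V] AE_I2)
      (auto intro!: V[THEN conjunct1])
  ultimately show ?thesis
    by (simp add: objective_def)
qed

lemma F_step: "n \<le> N \<Longrightarrow> F n x R = (SUP y\<in>feasible x R. objective (F (Suc n)) n x R y)"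
  by (simp add: F.simps[of n])

lemma F_terminal: "N < n \<Longrightarrow> F n x R = \<gamma> * x"
  by (simp add: F.simps[of n])

lemma no_order_feasible: "x \<in> feasible x R"
  by (simp add: feasible_def B_nonneg)

text \<open>Each remaining period earns at most \<open>p * D\<^sub>u\<close> and, without orders,
  loses at most \<open>W\<close>. These bounds make the real-valued \<open>SUP\<close> meaningful
  and the continuation integrable.\<close>

lemma F_bounds:
  assumes "1 \<le> n" "0 \<le> x"
  shows "- real (Suc N - n) * W \<le> F n x R
    \<and> F n x R \<le> real (Suc N - n) * (p * D\<^sub>u) + \<gamma> * x"
  using assms
\<comment> \<open>Backward induction on the number of remaining periods; truncated subtraction makes
  the base case exactly \<open>N < n\<close>.\<close>
proof (induction "Suc N - n" arbitrary: n x R)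
  case 0
  then show ?case
    using prices by (simp add: F_terminal)
next
  case (Suc k)
  then have n: "n \<in> {1..N}" and k: "Suc N - Suc n = k" "Suc N - n = Suc k"
    by auto
  have V: "- real k * W \<le> F (Suc n) x R \<and> F (Suc n) x R \<le> real k * (p * D\<^sub>u) + \<gamma> * x"
    if "0 \<le> x" for x R
    using Suc(1)[of "Suc n" x R] that unfolding k(1) by simp
  \<comment> \<open>Being uniform in \<open>y\<close>, this bound yields both the boundedness
    required by \<open>cSUP_upper\<close> and the upper estimate of the supremum.\<close>
  have le: "objective (F (Suc n)) n x R y \<le> real (Suc k) * (p * D\<^sub>u) + \<gamma> * x"
    if "y \<in> feasible x R" for y
    using objective_le[OF n \<open>0 \<le> x\<close>, of y _ "F (Suc n)" _ R, OF _ V] that by (simp add: feasible_def algebra_simps)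
  have "objective (F (Suc n)) n x R x \<le> F n x R"
    using n le by (auto simp: F_step intro!: cSUP_upper no_order_feasible bdd_aboveI2)
  moreover have "F n x R \<le> real (Suc k) * (p * D\<^sub>u) + \<gamma> * x"
    using n le no_order_feasible by (auto simp: F_step intro!: cSUP_least)
  moreover have "- real (Suc k) * W \<le> objective (F (Suc n)) n x R x"
    using objective_no_order_ge[OF n \<open>0 \<le> x\<close>, of _ "F (Suc n)" _ R, OF V] by (simp add: algebra_simps)
  ultimately show ?case
    unfolding k by linarith
qed

lemma objective_le_F:
  assumes n: "n \<in> {1..N}" and x: "0 \<le> x" and y: "y \<in> feasible x R"
  shows "objective (F (Suc n)) n x R y \<le> F n x R"
proof -
  have "objective (F (Suc n)) n x R z
      \<le> p * D\<^sub>u + real (Suc N - Suc n) * (p * D\<^sub>u) + \<gamma> * x" if "z \<in> feasible x R" for z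
    using objective_le[OF n x, of z _ "F (Suc n)" _ R, OF _ F_bounds] that by (simp add: feasible_def)
  then show ?thesis
    using n y by (auto simp: F_step intro!: cSUP_upper bdd_aboveI2)
qed

lemma integrable_F_continuation:
  assumes "n \<in> {1..N}" "0 \<le> y"
  shows "integrable M (\<lambda>\<omega>. F (Suc n) (max 0 (y - \<xi> n \<omega>)) (R + cash_incr (\<xi> n \<omega>) x y))"
  by (rule integrable_continuation[OF assms prices(1) F_bounds]) auto

text \<open>More cash enlarges the feasible set, and \<open>cash_incr\<close> does not depend on
  cash. The same level \<open>y\<close> thus leads to the same stock with more cash in the next
  period, where the induction hypothesis applies.\<close>

lemma F_mono_cash:
  assumes "1 \<le> n" "0 \<le> x" "R \<le> R'"
  shows "F n x R \<le> F n x R'"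
  using assms
proof (induction "Suc N - n" arbitrary: n x R R')
  case 0
  then show ?case
    by (simp add: F_terminal)
next
  case (Suc k)
  then have n: "n \<in> {1..N}"
    by auto
  have "objective (F (Suc n)) n x R y \<le> F n x R'" if y: "y \<in> feasible x R" for y
  proof -
    have y0: "0 \<le> y" and y': "y \<in> feasible x R'"
      using y Suc.prems B_mono[of R R'] by (auto simp: feasible_def)
    have "expectation (\<lambda>\<omega>. F (Suc n) (max 0 (y - \<xi> n \<omega>)) (R + cash_incr (\<xi> n \<omega>) x y))
        \<le> expectation (\<lambda>\<omega>. F (Suc n) (max 0 (y - \<xi> n \<omega>)) (R' + cash_incr (\<xi> n \<omega>) x y))"
      using Suc.hyps Suc.prems by (intro integral_mono integrable_F_continuation n y0) auto
    then have "objective (F (Suc n)) n x R y \<le> objective (F (Suc n)) n x R' y"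
      by (simp add: objective_def)
    also have "\<dots> \<le> F n x R'"
      by (rule objective_le_F[OF n \<open>0 \<le> x\<close> y'])
    finally show ?thesis .
  qed
  then show ?case
    using n no_order_feasible by (auto simp: F_step intro!: cSUP_least)
qed

lemma optimal_levelI:
  assumes "\<And>y. x \<le> y \<Longrightarrow> y \<le> x + B R \<Longrightarrow>
    objective (F (Suc n)) n x R y \<le> objective (F (Suc n)) n x R x"
  shows "optimal_level n x R x"
  using assms no_order_feasible
  by (force simp: optimal_level_def is_arg_max_def feasible_def not_less)

lemma C_threshold_fixed_cost: "C_threshold n x K"
  unfolding C_threshold_def
proof (intro allI impI optimal_levelI)
  fix R y assume "R \<le> K" "x \<le> y" "y \<le> x + B R"
  \<comment> \<open>Since \<open>W\<close> is nonnegative, \<open>R - K - W\<close> is at most 0, so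
    \<open>x\<close> is the only feasible level.\<close>
  moreover have "B R = 0"
    using \<open>R \<le> K\<close> costs_nonneg price_pos by (simp add: B_def divide_le_0_iff)
  ultimately show "objective (F (Suc n)) n x R y \<le> objective (F (Suc n)) n x R x"
    by simp
qed

text \<open>Both conditions are imposed at \<open>C\<close> and pass to every smaller
  \<open>R\<close> by monotonicity of \<open>B\<close>. Ordering is then compared with not ordering
  separately for each demand outcome.\<close>

lemma C_threshold_unprofitable_order:
  assumes n: "n \<in> {1..N}" and x: "0 \<le> x"
    and C: "x + B C \<le> D\<^sub>b" "p * B C \<le> K + c * B C"
  shows "C_threshold n x C"
  unfolding C_threshold_def
proof (intro allI impI optimal_levelI)
  fix R y assume R: "R \<le> C" and y: "x \<le> y" "y \<le> x + B R"
  show "objective (F (Suc n)) n x R y \<le> objective (F (Suc n)) n x R x"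
  proof (cases "y = x")
    case False
    have yC: "y - x \<le> B C" "0 \<le> y"
      using y x B_mono[OF R] by auto
    \<comment> \<open>As \<open>p\<close> exceeds \<open>c\<close>, the margin grows with the order
      size, so it suffices to know that the largest order does not recover \<open>K\<close>.\<close>
    have "(p - c) * (y - x) \<le> (p - c) * B C"
      using prices yC by (intro mult_left_mono) auto
    then have margin: "(p - c) * (y - x) \<le> K"
      using C by (simp add: algebra_simps)
    have sold_out: "y \<le> \<xi> n \<omega>" "x \<le> \<xi> n \<omega>" if "\<omega> \<in> space M" for \<omega>
      using demand_range[OF n that] C yC B_nonneg[of C] by auto
    \<comment> \<open>With everything sold and the fixed cost charged, the difference of the two
      sides is \<open>(p - c) * (y - x) - K\<close>.\<close>
    have incr: "cash_incr (\<xi> n \<omega>) x y \<le> cash_incr (\<xi> n \<omega>) x x" if "\<omega> \<in> space M" for \<omega>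
      using margin sold_out[OF that] False y
      by (simp add: cash_incr_def order_ind_def min_absorb2 algebra_simps)
    have "expectation (\<lambda>\<omega>. cash_incr (\<xi> n \<omega>) x y) \<le> expectation (\<lambda>\<omega>. cash_incr (\<xi> n \<omega>) x x)"
      by (intro integral_mono integrable_cash_incr n x yC incr)
    \<comment> \<open>Both next stocks are 0, so only the cash arguments differ and
      \<open>F_mono_cash\<close> applies pointwise.\<close>
    moreover have "expectation (\<lambda>\<omega>. F (Suc n) (max 0 (y - \<xi> n \<omega>)) (R + cash_incr (\<xi> n \<omega>) x y))
        \<le> expectation (\<lambda>\<omega>. F (Suc n) (max 0 (x - \<xi> n \<omega>)) (R + cash_incr (\<xi> n \<omega>) x x))"
      by (intro integral_mono integrable_F_continuation n x yC)
        (use sold_out incr in \<open>auto simp: max_absorb1 intro!: F_mono_cash\<close>)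
    ultimately show ?thesis
      by (simp add: objective_def)
  qed simp
qed

end

theorem lemma4:
  fixes M :: "'a measure" and N n :: nat and \<xi> :: "nat \<Rightarrow> 'a \<Rightarrow> real"
    and D\<^sub>b D\<^sub>u K c p \<gamma> W x :: real
  assumes "cash_inventory M N \<xi> D\<^sub>b D\<^sub>u K c p \<gamma> W"
    and "n \<in> {1..N}"
    and "x \<ge> 0"
    and "\<not> cash_inventory.s_threshold M N \<xi> K c p \<gamma> W n x"
  shows "(\<exists>C. cash_inventory.C_threshold M N \<xi> K c p \<gamma> W n x C) \<and>
    cash_inventory.C_threshold M N \<xi> K c p \<gamma> W n x K \<and>
    (\<forall>C. let S = {R. x + cash_inventory.B K c W R \<le> D\<^sub>b \<and>
                     p * cash_inventory.B K c W R \<le> K + c * cash_inventory.B K c W R}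
         in C \<in> S \<and> (\<forall>R\<in>S. R \<le> C) \<longrightarrow>
            cash_inventory.C_threshold M N \<xi> K c p \<gamma> W n x C)"
proof -
  interpret cash_inventory M N \<xi> D\<^sub>b D\<^sub>u K c p \<gamma> W
    by (rule assms(1))
  show ?thesis
    \<comment> \<open>Existence follows with \<open>K\<close> as witness; a maximum of
      \<open>S\<close> is a threshold through its membership in \<open>S\<close>.\<close>
    using C_threshold_fixed_cost C_threshold_unprofitable_order[OF assms(2,3)]
    by (auto simp: Let_def)
qed

end
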